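(* Let $\{\mathcal{G}_j : j \in J\}$ be an HS-frame for $\mathbb{H}$ with respect to $\mathbb{K}$ and let $\{\tilde{\mathcal{G}}_j : j \in J\}$ be the canonical dual HS-frame of $\{\mathcal{G}_j : j \in J\}$. Then for any $\lambda \in [0,1]$, all $K \subset J$ and all $f \in \mathbb{H}$, \begin{eqnarray*} \sum_{j \in J}\Vert \tilde{\mathcal{G}}_j S_{K}f \Vert_2^2 +\sum_{j \in K^c} \Vert \mathcal{G}_j(f)\Vert_2^2 &=& \sum_{j \in J}\Vert \tilde{\mathcal{G}}_j S_{K^c}f \Vert_2^2 +\sum_{j \in K} \Vert \mathcal{G}_j(f)\Vert_2^2 \\ &\geq & (2 \lambda- \lambda^2) \sum_{j \in K} \Vert \mathcal{G}_j(f)\Vert_2^2 +(1 - \lambda^2) \sum_{j \in K^c} \Vert \mathcal{G}_j(f)\Vert_2^2 . \end{eqnarray*}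
   Context: $\mathbb{H}$ and $\mathbb{K}$ are complex Hilbert spaces, $J$ is a countable index set, and $K^c = J \setminus K$ for $K \subset J$. $C_2 \subseteq \mathcal{L}(\mathbb{K})$ denotes the Hilbert-Schmidt class of operators on $\mathbb{K}$, a Hilbert space with inner product $[T,S]_\tau = \tau(S^*T)$ ($\tau$ the usual trace) and norm $\Vert T\Vert_2 = [T,T]_\tau^{1/2}$. A family $\{\mathcal{G}_j : j \in J\}$ of bounded linear operators from $\mathbb{H}$ to $C_2 \subseteq \mathcal{L}(\mathbb{K})$ is a Hilbert-Schmidt frame (HS-frame) for $\mathbb{H}$ with respect to $\mathbb{K}$ if there are constants $A,B>0$ such that $A\Vert f\Vert^2 \le \sum_{j\in J}\Vert \mathcal{G}_j(f)\Vert_2^2 \le B\Vert f\Vert^2$ for all $f\in\mathbb{H}$. $\mathcal{G}_j^*: C_2 \to \mathbb{H}$ is the adjoint of $\mathcal{G}_j$. The HS-frame operator is $S:\mathbb{H}\to\mathbb{H}$, $Sf=\sum_{j\in J}\mathcal{G}_j^*\mathcal{G}_j(f)$; it is bounded, invertible, self-adjoint and positive. The canonical dual HS-frame is $\{\tilde{\mathcal{G}}_j = \mathcal{G}_j S^{-1} : j\in J\}$. For $K\subset J$, $S_K:\mathbb{H}\to\mathbb{H}$ is the bounded operator $S_K f = \sum_{j\in K}\mathcal{G}_j^*\mathcal{G}_j(f)$, and likewise $S_{K^c}f=\sum_{j\in K^c}\mathcal{G}_j^*\mathcal{G}_j(f)$. Series in $\mathbb{H}$ are understood as unconditionally convergent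 in norm. *)

theory Defs
  imports "HOL-Analysis.Analysis"
begin

text \<open>
  A complex Hilbert space: a real Banach space with a compatible complex scalar multiplication and
  a complex inner product that induces the norm. The inner product is linear in its
  \<^emph>\<open>first\<close> argument.
\<close>

class complex_hilbert = banach +
  fixes scaleC :: "complex \<Rightarrow> 'a \<Rightarrow> 'a"  (infixr "*\<^sub>C" 75)
    and cinner :: "'a \<Rightarrow> 'a \<Rightarrow> complex"
  assumes scaleC_add_right: "a *\<^sub>C (x + y) = a *\<^sub>C x + a *\<^sub>C y"
    and scaleC_add_left: "(a + b) *\<^sub>C x = a *\<^sub>C x + b *\<^sub>C x"
    and scaleC_scaleC: "a *\<^sub>C b *\<^sub>C x = (a * b) *\<^sub>C x"
    and scaleC_of_real: "complex_of_real r *\<^sub>C x = r *\<^sub>R x"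
    and cinner_commute: "cinner x y = cnj (cinner y x)"
    and cinner_add_left: "cinner (x + y) z = cinner x z + cinner y z"
    and cinner_scaleC_left: "cinner (a *\<^sub>C x) y = a * cinner x y"
    and norm_eq_sqrt_cinner: "norm x = sqrt (Re (cinner x x))"

instantiation complex :: complex_hilbert
begin

definition scaleC_complex :: "complex \<Rightarrow> complex \<Rightarrow> complex"
  where "scaleC_complex a x = a * x"

definition cinner_complex :: "complex \<Rightarrow> complex \<Rightarrow> complex"
  where "cinner_complex x y = x * cnj y"

instance
  by standard
    (simp_all add: scaleC_complex_def cinner_complex_def algebra_simps scaleR_conv_of_real
      cmod_def power2_eq_square)

end

definition bounded_clinear :: "('a::complex_hilbert \<Rightarrow> 'b::complex_hilbert) \<Rightarrow> bool"
  where "bounded_clinear T \<longleftrightarrow> bounded_linear T \<and> (\<forall>c x. T (c *\<^sub>C x) = c *\<^sub>C T x)"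

definition cadjoint :: "('a::complex_hilbert \<Rightarrow> 'b::complex_hilbert) \<Rightarrow> 'b \<Rightarrow> 'a"
  where "cadjoint T y = (THE z. \<forall>x. cinner (T x) y = cinner x z)"


subsection \<open>Orthonormal bases and the trace\<close>

definition orthonormal :: "'a::complex_hilbert set \<Rightarrow> bool"
  where "orthonormal E \<longleftrightarrow> (\<forall>e\<in>E. \<forall>e'\<in>E. cinner e e' = (if e = e' then 1 else 0))"

definition is_onb :: "'a::complex_hilbert set \<Rightarrow> bool"
  where "is_onb E \<longleftrightarrow> orthonormal E \<and> (\<forall>x. (\<forall>e\<in>E. cinner x e = 0) \<longrightarrow> x = 0)"

lemma exists_onb: "\<exists>E::'a::complex_hilbert set. is_onb E"
proof -
  have "\<exists>M\<in>Collect orthonormal. \<forall>X\<in>Collect (orthonormal :: 'a set \<Rightarrow> bool). M \<subseteq> X \<longrightarrow> X = M"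
  proof (rule subset_Zorn')
    fix C :: "'a set set"
    assume C: "subset.chain (Collect orthonormal) C"
    show "\<Union> C \<in> Collect orthonormal"
      unfolding mem_Collect_eq orthonormal_def
    proof (intro ballI)
      fix e e' assume "e \<in> \<Union> C" "e' \<in> \<Union> C"
      then obtain X Y where "X \<in> C" "Y \<in> C" "e \<in> X" "e' \<in> Y" by blast
      moreover have "X \<subseteq> Y \<or> Y \<subseteq> X"
        using C \<open>X \<in> C\<close> \<open>Y \<in> C\<close> by (auto simp: subset.chain_def)
      ultimately obtain Z where "Z \<in> C" "e \<in> Z" "e' \<in> Z" by blast
      moreover have "orthonormal Z"
        using C \<open>Z \<in> C\<close> by (auto simp: subset.chain_def)
      ultimately show "cinner e e' = (if e = e' then 1 else 0)"
        by (simp add: orthonormal_def)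
    qed
  qed
  then obtain M :: "'a set" where M: "orthonormal M"
    and max: "\<And>X. orthonormal X \<Longrightarrow> M \<subseteq> X \<Longrightarrow> X = M"
    by blast
  have "x = 0" if x: "\<forall>e\<in>M. cinner x e = 0" for x
  proof (rule ccontr)
    assume "x \<noteq> 0"
    define u where "u = complex_of_real (inverse (norm x)) *\<^sub>C x"
    have real: "Im (cinner y y) = 0" for y :: 'a
      using cinner_commute[of y y] by (metis complex_cnj_cancel_iff Reals_cnj_iff complex_is_Real_iff)
    have "norm u = 1"
      using \<open>x \<noteq> 0\<close> by (simp only: u_def scaleC_of_real) simp
    then have uu: "cinner u u = 1"
      using real[of u] by (simp add: norm_eq_sqrt_cinner complex_eq_iff)
    have ue: "cinner u e = 0" if "e \<in> M" for e
      using x that by (simp add: u_def cinner_scaleC_left)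
    have eu: "cinner e u = 0" if "e \<in> M" for e
      using ue[OF that] cinner_commute[of e u] by simp
    have "u \<notin> M"
      using uu ue[of u] by auto
    have "orthonormal (insert u M)"
      using M uu ue eu \<open>u \<notin> M\<close> by (auto simp: orthonormal_def)
    with max[of "insert u M"] \<open>u \<notin> M\<close> show False by blast
  qed
  with M show ?thesis
    by (auto simp: is_onb_def)
qed

definition some_onb :: "'a::complex_hilbert set"
  where "some_onb = (SOME E. is_onb E)"

lemma is_onb_some_onb: "is_onb some_onb"
  unfolding some_onb_def using exists_onb by (rule someI_ex)

text \<open>On trace-class operators the value does not depend on the chosen orthonormal basis.\<close>

definition trace_op :: "('k::complex_hilbert \<Rightarrow> 'k) \<Rightarrow> complex"
  where "trace_op A = (\<Sum>\<^sub>\<infinity>e\<in>some_onb. cinner (A e) e)"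


subsection \<open>The Hilbert-Schmidt class\<close>

definition hs_class :: "('k::complex_hilbert \<Rightarrow> 'k) set"
  where "hs_class =
    {T. bounded_clinear T \<and> (\<exists>E. is_onb E \<and> (\<lambda>e. (norm (T e))\<^sup>2) summable_on E)}"

definition hs_inner :: "('k::complex_hilbert \<Rightarrow> 'k) \<Rightarrow> ('k \<Rightarrow> 'k) \<Rightarrow> complex"
  where "hs_inner T S = trace_op (cadjoint S \<circ> T)"

definition hs_norm :: "('k::complex_hilbert \<Rightarrow> 'k) \<Rightarrow> real"
  where "hs_norm T = sqrt (Re (hs_inner T T))"

text \<open>
  Bounded complex-linear operators into \<^const>\<open>hs_class\<close>, where the latter carries the norm
  \<^const>\<open>hs_norm\<close>, and their adjoints with respect to \<^const>\<open>hs_inner\<close>.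
\<close>

definition bounded_hs_operator :: "('h::complex_hilbert \<Rightarrow> 'k::complex_hilbert \<Rightarrow> 'k) \<Rightarrow> bool"
  where "bounded_hs_operator G \<longleftrightarrow>
    (\<forall>f. G f \<in> hs_class) \<and>
    (\<forall>f g. G (f + g) = (\<lambda>x. G f x + G g x)) \<and>
    (\<forall>c f. G (c *\<^sub>C f) = (\<lambda>x. c *\<^sub>C G f x)) \<and>
    (\<exists>C. \<forall>f. hs_norm (G f) \<le> C * norm f)"

definition hs_adjoint ::
    "('h::complex_hilbert \<Rightarrow> 'k::complex_hilbert \<Rightarrow> 'k) \<Rightarrow> ('k \<Rightarrow> 'k) \<Rightarrow> 'h"
  where "hs_adjoint G T = (THE h. \<forall>f. hs_inner (G f) T = cinner f h)"


subsection \<open>Hilbert-Schmidt frames\<close>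

definition hs_frame ::
    "'i set \<Rightarrow> ('i \<Rightarrow> 'h::complex_hilbert \<Rightarrow> 'k::complex_hilbert \<Rightarrow> 'k) \<Rightarrow> bool"
  where "hs_frame J G \<longleftrightarrow>
    (\<forall>j\<in>J. bounded_hs_operator (G j)) \<and>
    (\<exists>A B. A > 0 \<and> B > 0 \<and>
      (\<forall>f. (\<lambda>j. (hs_norm (G j f))\<^sup>2) summable_on J \<and>
           A * (norm f)\<^sup>2 \<le> (\<Sum>\<^sub>\<infinity>j\<in>J. (hs_norm (G j f))\<^sup>2) \<and>
           (\<Sum>\<^sub>\<infinity>j\<in>J. (hs_norm (G j f))\<^sup>2) \<le> B * (norm f)\<^sup>2))"

text \<open>The frame operator is the case \<open>K = J\<close>. The infinite sum is unconditional.\<close>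

definition partial_frame_op ::
    "('i \<Rightarrow> 'h::complex_hilbert \<Rightarrow> 'k::complex_hilbert \<Rightarrow> 'k) \<Rightarrow> 'i set \<Rightarrow> 'h \<Rightarrow> 'h"
  where "partial_frame_op G K f = (\<Sum>\<^sub>\<infinity>j\<in>K. hs_adjoint (G j) (G j f))"

definition canonical_dual ::
    "'i set \<Rightarrow> ('i \<Rightarrow> 'h::complex_hilbert \<Rightarrow> 'k::complex_hilbert \<Rightarrow> 'k) \<Rightarrow> 'i \<Rightarrow> 'h \<Rightarrow> 'k \<Rightarrow> 'k"
  where "canonical_dual J G j = G j \<circ> inv (partial_frame_op G J)"

end

theory Submission
  imports Defs
begin

text \<open>Write \<open>q x y\<close> for the real part of the inner product of \<open>x\<close>
  with \<open>S y\<close>, where \<open>S\<close> is the frame operator. This is a symmetric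
  positive semidefinite form, and \<open>q x x\<close> is the sum of the squared Hilbert-Schmidt
  norms of \<open>G j x\<close>. Since the operators of \<open>K\<close> and \<open>J - K\<close>
  add up to \<open>S\<close>, their values at \<open>f\<close> have \<open>S\<close>-preimages
  \<open>u\<close> and \<open>v\<close> with \<open>u + v = f\<close>. The dual sums are then
  \<open>q u u\<close> and \<open>q v v\<close>, while the sums over \<open>K\<close> and
  \<open>J - K\<close> are \<open>q f u\<close> and \<open>q f v\<close>. Both sides of the equality
  become \<open>q u u + q u v + q v v\<close>, and the inequality is the nonnegativity of
  \<open>q\<close> at one combination of \<open>u\<close> and \<open>v\<close>.

  Most of the work makes these manipulations legitimate, because adjoints are definite descriptions,
  infinite sums default to 0, and \<open>inv\<close> is informative only for a bijection.
  \<open>symmetric_lax_milgram\<close> yields both Riesz representation (hence the adjoints) and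
  surjectivity of \<open>S\<close> (\<open>bij_frame_op\<close>). \<open>parseval\<close> frees the
  Hilbert-Schmidt condition from the choice of basis, so that \<open>hs_inner\<close> is a
  convergent sum. \<open>norm_sq_le_if_has_sum\<close> gives convergence of the frame series and
  boundedness of its sum.\<close>

section \<open>Hilbert space preliminaries\<close>

lemma cinner_add_right: "cinner x (y + z) = cinner x y + cinner x z"
  by (metis cinner_commute cinner_add_left complex_cnj_add)

lemma cinner_scaleC_right: "cinner x (a *\<^sub>C y) = cnj a * cinner x y"
  by (metis cinner_commute cinner_scaleC_left complex_cnj_mult)

lemma cinner_scaleR_left: "cinner (r *\<^sub>R x) y = r *\<^sub>R cinner x y"
  using cinner_scaleC_left[of "complex_of_real r" x y]
  by (simp add: scaleC_of_real scaleR_conv_of_real)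

lemma cinner_scaleR_right: "cinner x (r *\<^sub>R y) = r *\<^sub>R cinner x y"
  using cinner_scaleC_right[of x "complex_of_real r" y]
  by (simp add: scaleC_of_real scaleR_conv_of_real)

lemma cinner_self: "cinner x x = complex_of_real ((norm x)\<^sup>2)"
proof -
  have "Im (cinner x x) = 0"
    by (metis cinner_commute Reals_cnj_iff complex_is_Real_iff)
  moreover have "(norm x)\<^sup>2 = Re (cinner x x)"
  proof -
    \<comment> \<open>Positivity of the inner product is not an axiom of the class. It follows
      because \<open>sqrt\<close> of a negative real is negative, whereas a norm is not.\<close>
    have "0 \<le> sqrt (Re (cinner x x))"
      by (metis norm_eq_sqrt_cinner norm_ge_zero)
    then show ?thesis
      by (simp add: norm_eq_sqrt_cinner)
  qed
  ultimately show ?thesis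
    by (simp add: complex_eq_iff)
qed

lemma Re_cinner_commute: "Re (cinner x y) = Re (cinner y x)"
  by (subst cinner_commute) simp

lemma norm_add_sq: "(norm (x + y))\<^sup>2 = (norm x)\<^sup>2 + 2 * Re (cinner x y) + (norm y)\<^sup>2"
proof -
  have "(norm (x + y))\<^sup>2 = Re (cinner (x + y) (x + y))"
    by (simp add: cinner_self)
  also have "\<dots> = (norm x)\<^sup>2 + 2 * Re (cinner x y) + (norm y)\<^sup>2"
    unfolding cinner_add_left cinner_add_right
    using Re_cinner_commute[of y x] by (simp add: cinner_self)
  finally show ?thesis .
qed

text \<open>Cauchy-Schwarz is read off from the triangle inequality, which the normed space already
  provides.\<close>

lemma Re_cinner_le: "Re (cinner x y) \<le> norm x * norm y"
proof -
  have "(norm (x + y))\<^sup>2 \<le> (norm x + norm y)\<^sup>2"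
    by (intro power_mono norm_triangle_ineq) auto
  then show ?thesis
    by (simp add: norm_add_sq power2_sum)
qed

lemma norm_scaleC: "norm (a *\<^sub>C x) = cmod a * norm x"
proof -
  have "complex_of_real ((norm (a *\<^sub>C x))\<^sup>2) = (a * cnj a) * cinner x x"
    by (simp only: cinner_self [symmetric] cinner_scaleC_left cinner_scaleC_right mult_ac)
  also have "\<dots> = complex_of_real ((cmod a * norm x)\<^sup>2)"
    by (simp add: complex_norm_square [symmetric] cinner_self power_mult_distrib)
  finally show ?thesis
    by (metis of_real_eq_iff power2_eq_imp_eq norm_ge_zero mult_nonneg_nonneg)
qed

lemma cmod_cinner_le: "cmod (cinner x y) \<le> norm x * norm y"
proof (cases "cinner x y = 0")
  case False
  \<comment> \<open>The phase that rotates the inner product onto the positive real axis.\<close>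
  define u where "u = cnj (cinner x y) / cmod (cinner x y)"
  have "cmod u = 1"
    using False by (simp add: u_def norm_divide)
  have "cmod (cinner x y) = Re (cinner (u *\<^sub>C x) y)"
    using False
    by (simp add: u_def cinner_scaleC_left mult.commute [of "cnj _"] complex_norm_square [symmetric]
        power2_eq_square)
  also have "\<dots> \<le> norm x * norm y"
    using Re_cinner_le[of "u *\<^sub>C x" y] \<open>cmod u = 1\<close> by (simp add: norm_scaleC)
  finally show ?thesis .
qed simp

lemma bounded_bilinear_cinner: "bounded_bilinear cinner"
  by (rule bounded_bilinear.intro)
    (auto simp: cinner_add_left cinner_add_right cinner_scaleR_left cinner_scaleR_right
      intro!: exI[of _ 1] cmod_cinner_le)

lemma bounded_bilinear_Re_cinner: "bounded_bilinear (\<lambda>x y. Re (cinner x y))"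
  by (rule bounded_bilinear.intro)
    (auto simp: cinner_add_left cinner_add_right cinner_scaleR_left cinner_scaleR_right
      intro!: exI[of _ 1] order_trans[OF abs_Re_le_cmod] cmod_cinner_le)

lemmas cinner_sum_left = bounded_bilinear.sum_left[OF bounded_bilinear_cinner]
  and cinner_sum_right = bounded_bilinear.sum_right[OF bounded_bilinear_cinner]
  and bounded_linear_cinner_left = bounded_bilinear.bounded_linear_left[OF bounded_bilinear_cinner]
  and bounded_linear_cinner_right = bounded_bilinear.bounded_linear_right[OF bounded_bilinear_cinner]

lemma eq_if_Re_cinner_eq:
  assumes "\<And>x. Re (cinner x y) = Re (cinner x z)"
  shows "y = z"
proof -
  have "Re (cinner (y - z) (y - z)) = 0"
    using assms[of "y - z"] by (simp add: bounded_bilinear.diff_right[OF bounded_bilinear_cinner])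
  then show ?thesis
    by (simp add: cinner_self)
qed

section \<open>Minimisation, Riesz representation and adjoints\<close>

text \<open>
  The minimiser of \<open>b x x - 2 \<phi> x\<close>; by the parallelogram law for \<open>b\<close>, coercivity makes
  every minimising sequence Cauchy.
\<close>

lemma symmetric_lax_milgram:
  fixes b :: "'a::banach \<Rightarrow> 'a \<Rightarrow> real"
  assumes b: "bounded_bilinear b" and sym: "\<And>x y. b x y = b y x"
    and coercive: "0 < A" "\<And>x. A * (norm x)\<^sup>2 \<le> b x x"
    and \<phi>: "bounded_linear \<phi>"
  shows "\<exists>z. \<forall>x. \<phi> x = b x z"
proof -
  interpret b: bounded_bilinear b by fact
  interpret \<phi>: bounded_linear \<phi> by fact
  define I where "I x = b x x - 2 * \<phi> x" for x
  obtain C where C: "C > 0" "\<And>x. norm (\<phi> x) \<le> norm x * C"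
    using \<phi>.pos_bounded by blast
  \<comment> \<open>Complete the square in \<open>A * s^2 - 2 * C * s\<close> with
    \<open>s = norm x\<close>.\<close>
  have "- (C\<^sup>2 / A) \<le> I x" for x
  proof -
    have "0 \<le> (A * norm x - C)\<^sup>2 / A"
      using coercive(1) by simp
    also have "\<dots> = A * (norm x)\<^sup>2 - 2 * (norm x * C) + C\<^sup>2 / A"
      using coercive(1) by (simp add: power2_diff field_simps power2_eq_square)
    finally show ?thesis
      using coercive(2)[of x] C(2)[of x] by (simp add: I_def)
  qed
  then have bdd: "bdd_below (range I)"
    by (intro bdd_belowI2)
  define m where "m = Inf (range I)"
  have m_le: "m \<le> I x" for x
    unfolding m_def by (rule cInf_lower) (auto simp: bdd)
  have "\<exists>x. I x < m + inverse (Suc n)" for n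
    using cInf_lessD[of "range I" "m + inverse (Suc n)"] by (auto simp: m_def)
  then obtain X where X: "\<And>n. I (X n) < m + inverse (Suc n)"
    by metis
  have parallelogram: "b (x - y) (x - y) = 2 * I x + 2 * I y - 4 * I ((1/2) *\<^sub>R (x + y))" for x y
    using sym[of x y]
    by (simp add: I_def b.add_left b.add_right b.diff_left b.diff_right b.scaleR_left
        b.scaleR_right \<phi>.add \<phi>.scaleR algebra_simps)
  have close: "A * (norm (X i - X j))\<^sup>2 \<le> 2 * inverse (Suc i) + 2 * inverse (Suc j)" for i j
    using coercive(2)[of "X i - X j"] parallelogram[of "X i" "X j"] X[of i] X[of j]
      m_le[of "(1/2) *\<^sub>R (X i + X j)"] by linarith
  have "Cauchy X"
  proof (rule metric_CauchyI)
    fix e :: real assume "e > 0"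
    then obtain N where N: "inverse (real (Suc N)) < A * e\<^sup>2 / 4"
      using reals_Archimedean[of "A * e\<^sup>2 / 4"] coercive(1) by auto
    have "dist (X i) (X j) < e" if "i \<ge> N" "j \<ge> N" for i j
    proof -
      have "inverse (real (Suc i)) \<le> inverse (real (Suc N))"
        "inverse (real (Suc j)) \<le> inverse (real (Suc N))"
        using that by (auto intro!: le_imp_inverse_le)
      then have "A * (norm (X i - X j))\<^sup>2 < A * e\<^sup>2"
        using close[of i j] N by linarith
      then show ?thesis
        using coercive(1) \<open>e > 0\<close> by (simp add: dist_norm power_less_imp_less_base)
    qed
    then show "\<exists>N. \<forall>i\<ge>N. \<forall>j\<ge>N. dist (X i) (X j) < e"
      by blast
  qed
  then obtain z where z: "X \<longlonglongrightarrow> z"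
    using Cauchy_convergent_iff convergent_def by blast
  have "(\<lambda>n. I (X n)) \<longlonglongrightarrow> I z"
    unfolding I_def by (intro tendsto_intros b.tendsto \<phi>.tendsto z)
  moreover have "(\<lambda>n. m + inverse (real (Suc n))) \<longlonglongrightarrow> m + 0"
    by (intro tendsto_intros LIMSEQ_inverse_real_of_nat)
  ultimately have "I z \<le> m + 0"
    by (rule LIMSEQ_le) (use X less_imp_le in blast)
  then have "I z \<le> m"
    by simp
  have "\<phi> x = b x z" for x
  proof -
    \<comment> \<open>First variation: moving from the minimiser \<open>z\<close> in direction
      \<open>x\<close> cannot decrease \<open>I\<close>.\<close>
    have ge: "0 \<le> t\<^sup>2 * b x x + 2 * t * (b x z - \<phi> x)" for t
    proof -
      have "0 \<le> I (z + t *\<^sub>R x) - I z"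
        using m_le[of "z + t *\<^sub>R x"] \<open>I z \<le> m\<close> by linarith
      then show ?thesis
        using sym[of x z]
        by (simp add: I_def b.add_left b.add_right b.scaleR_left b.scaleR_right \<phi>.add \<phi>.scaleR
            algebra_simps power2_eq_square)
    qed
    define d where "d = b x z - \<phi> x"
    \<comment> \<open>The summand 1 keeps \<open>p\<close> positive when \<open>b x x = 0\<close>,
      so \<open>t = - d / p\<close> is admissible. It makes the variation a negative multiple of
      \<open>d^2\<close>, which forces \<open>d = 0\<close>.\<close>
    define p where "p = b x x + 1"
    have p: "p > 0"
      using coercive(1) order_trans[OF _ coercive(2)[of x]] by (simp add: p_def add_nonneg_pos)
    have "0 \<le> (d / p)\<^sup>2 * (p - 1) - 2 * (d / p) * d"
    proof -
      have "b x x = p - 1" "b x z - \<phi> x = d"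
        by (simp_all add: p_def d_def)
      then show ?thesis
        using ge[of "- d / p"] by simp
    qed
    also have "\<dots> = - (d\<^sup>2 * (p + 1) / p\<^sup>2)"
      using p by (simp add: field_simps power2_eq_square)
    finally have "d\<^sup>2 * (p + 1) / p\<^sup>2 \<le> 0"
      by simp
    then have "d = 0"
      using p by (auto simp: divide_le_0_iff mult_le_0_iff)
    then show ?thesis
      by (simp add: d_def)
  qed
  then show ?thesis
    by blast
qed

text \<open>The minimisation argument represents only the real part. Complex linearity recovers the
  imaginary part by evaluating at \<open>\<i> *\<^sub>C x\<close>.\<close>

lemma riesz_representation:
  fixes \<phi> :: "'a::complex_hilbert \<Rightarrow> complex"
  assumes \<phi>: "bounded_linear \<phi>" and scale: "\<And>c x. \<phi> (c *\<^sub>C x) = c * \<phi> x"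
  shows "\<exists>!z. \<forall>x. \<phi> x = cinner x z"
proof -
  have "\<exists>z. \<forall>x. Re (\<phi> x) = Re (cinner x z)"
    by (rule symmetric_lax_milgram[OF bounded_bilinear_Re_cinner, where A = 1])
      (auto simp: cinner_self intro: Re_cinner_commute bounded_linear_compose[OF bounded_linear_Re \<phi>])
  then obtain z where z: "\<And>x. Re (\<phi> x) = Re (cinner x z)"
    by blast
  have "Im (\<phi> x) = Im (cinner x z)" for x
    using z[of "\<i> *\<^sub>C x"] by (simp add: scale cinner_scaleC_left)
  with z have "\<forall>x. \<phi> x = cinner x z"
    by (simp add: complex_eq_iff)
  moreover have "y = z" if "\<forall>x. \<phi> x = cinner x y" for y
    using that z by (intro eq_if_Re_cinner_eq) metis
  ultimately show ?thesis
    by blast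
qed

lemma cinner_cadjoint:
  assumes "bounded_clinear T"
  shows "cinner (T x) y = cinner x (cadjoint T y)"
proof -
  have "bounded_linear (\<lambda>x. cinner (T x) y)"
    using assms bounded_linear_compose[OF bounded_linear_cinner_left]
    by (auto simp: bounded_clinear_def)
  moreover have "cinner (T (c *\<^sub>C x)) y = c * cinner (T x) y" for c x
    using assms by (simp add: bounded_clinear_def cinner_scaleC_left)
  ultimately have "\<exists>!z. \<forall>x. cinner (T x) y = cinner x z"
    by (rule riesz_representation)
  from theI'[OF this] show ?thesis
    unfolding cadjoint_def by blast
qed

section \<open>Unconditional sums in Hilbert spaces\<close>

text \<open>Finite sets disjoint from a large finite \<open>F0\<close> carry little of the
  convergent sum of \<open>a\<close>, so the partial sums of \<open>x\<close> form a Cauchy net.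
  This serves both orthonormal expansions and the frame series.\<close>

lemma summable_on_if_norm_sum_sq_le:
  fixes x :: "'i \<Rightarrow> 'a::banach" and a :: "'i \<Rightarrow> real"
  assumes a: "a summable_on A"
    and le: "\<And>F. finite F \<Longrightarrow> F \<subseteq> A \<Longrightarrow> (norm (sum x F))\<^sup>2 \<le> B * sum a F"
  shows "x summable_on A"
proof -
  have "\<exists>P. eventually P (finite_subsets_at_top A) \<and>
      (\<forall>F F'. P F \<and> P F' \<longrightarrow> dist (sum x F) (sum x F') < e)" if "e > 0" for e
  proof -
    \<comment> \<open>Chosen so that a tail of size \<open>2 * d\<close>, multiplied by
      \<open>\<bar>B\<bar>\<close>, stays below \<open>(e / 2)^2\<close>; the added 1 avoids
      division by zero.\<close>
    define d where "d = (e / 2)\<^sup>2 / (\<bar>B\<bar> + 1) / 2"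
    have "d > 0"
      using that by (simp add: d_def)
    have B: "\<bar>B\<bar> * (2 * d) < (e / 2)\<^sup>2"
      using that by (simp add: d_def field_simps)
    have "eventually (\<lambda>F. dist (sum a F) (infsum a A) < d) (finite_subsets_at_top A)"
      using infsum_tendsto[OF a] \<open>d > 0\<close> by (simp add: tendsto_iff)
    then obtain F0 where F0: "finite F0" "F0 \<subseteq> A"
      and near: "\<And>F. finite F \<Longrightarrow> F0 \<subseteq> F \<Longrightarrow> F \<subseteq> A \<Longrightarrow> dist (sum a F) (infsum a A) < d"
      by (auto simp: eventually_finite_subsets_at_top)
    have half: "dist (sum x F) (sum x F0) < e / 2" if F: "finite F" "F0 \<subseteq> F" "F \<subseteq> A" for F
    proof -
      have "\<bar>sum a (F - F0)\<bar> = dist (sum a F) (sum a F0)"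
        using F by (simp add: sum_diff dist_norm)
      also have "\<dots> < 2 * d"
        using near[OF F] near[OF F0(1) order_refl F0(2)]
          dist_triangle2[of "sum a F" "sum a F0" "infsum a A"] by linarith
      finally have small: "\<bar>sum a (F - F0)\<bar> < 2 * d" .
      have "(dist (sum x F) (sum x F0))\<^sup>2 = (norm (sum x (F - F0)))\<^sup>2"
        using F by (simp add: sum_diff dist_norm)
      also have "\<dots> \<le> B * sum a (F - F0)"
        using F by (intro le) auto
      also have "\<dots> \<le> \<bar>B\<bar> * \<bar>sum a (F - F0)\<bar>"
        by (metis abs_ge_self abs_mult)
      also have "\<dots> \<le> \<bar>B\<bar> * (2 * d)"
        using small by (intro mult_left_mono) auto
      also note B
      finally show ?thesis
        by (rule power_less_imp_less_base) (use \<open>e > 0\<close> in simp)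
    qed
    show ?thesis
    proof (intro exI[of _ "\<lambda>F. finite F \<and> F0 \<subseteq> F \<and> F \<subseteq> A"] conjI allI impI)
      show "\<forall>\<^sub>F F in finite_subsets_at_top A. finite F \<and> F0 \<subseteq> F \<and> F \<subseteq> A"
        using F0 by (auto simp: eventually_finite_subsets_at_top)
      fix F F'
      assume "(finite F \<and> F0 \<subseteq> F \<and> F \<subseteq> A) \<and> finite F' \<and> F0 \<subseteq> F' \<and> F' \<subseteq> A"
      then show "dist (sum x F) (sum x F') < e"
        using half[of F] half[of F'] dist_triangle2[of "sum x F" "sum x F'" "sum x F0"]
        by linarith
    qed
  qed
  then have "cauchy_filter (filtermap (sum x) (finite_subsets_at_top A))"
    by (simp add: cauchy_filter_metric_filtermap)
  moreover have "complete (UNIV::'a set)"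
    by (rule complete_UNIV)
  ultimately obtain L where "(sum x \<longlongrightarrow> L) (finite_subsets_at_top A)"
    using complete_uniform[where S = UNIV] by (force simp: filterlim_def)
  then show ?thesis
    by (auto simp: summable_on_def has_sum_def)
qed

lemma has_sum_Cauchy_Schwarz:
  fixes f :: "'i \<Rightarrow> 'a::real_normed_vector"
  assumes f: "(f has_sum s) A" "\<And>i. i \<in> A \<Longrightarrow> norm (f i) \<le> a i * b i"
    and a: "((\<lambda>i. (a i)\<^sup>2) has_sum p) A" and b: "((\<lambda>i. (b i)\<^sup>2) has_sum q) A"
  shows "norm s \<le> sqrt p * sqrt (q::real)"
proof (rule tendsto_upperbound)
  show "((\<lambda>F. norm (sum f F)) \<longlongrightarrow> norm s) (finite_subsets_at_top A)"
    using f(1) unfolding has_sum_def by (rule tendsto_norm)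
  have "norm (sum f F) \<le> sqrt p * sqrt q" if F: "finite F" "F \<subseteq> A" for F
  proof -
    have ap: "(\<Sum>i\<in>F. (a i)\<^sup>2) \<le> p" and bq: "(\<Sum>i\<in>F. (b i)\<^sup>2) \<le> q"
      by (rule finite_sum_le_has_sum[OF a F], simp) (rule finite_sum_le_has_sum[OF b F], simp)
    have "0 \<le> p" "0 \<le> q"
      using a b by (auto intro: has_sum_nonneg)
    have "norm (sum f F) \<le> (\<Sum>i\<in>F. a i * b i)"
      using F f(2) by (intro sum_norm_le) auto
    also have "\<dots> \<le> sqrt ((\<Sum>i\<in>F. a i * b i)\<^sup>2)"
      by simp
    also have "\<dots> \<le> sqrt ((\<Sum>i\<in>F. (a i)\<^sup>2) * (\<Sum>i\<in>F. (b i)\<^sup>2))"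
      using Cauchy_Schwarz_ineq_sum by (rule real_sqrt_le_mono)
    also have "\<dots> \<le> sqrt (p * q)"
      using ap bq \<open>0 \<le> p\<close> by (intro real_sqrt_le_mono mult_mono) (auto intro: sum_nonneg)
    finally show ?thesis
      by (simp add: real_sqrt_mult)
  qed
  then show "\<forall>\<^sub>F F in finite_subsets_at_top A. norm (sum f F) \<le> sqrt p * sqrt q"
    by (intro eventually_finite_subsets_at_top_weakI)
qed simp

section \<open>Orthonormal expansions\<close>

text \<open>Bessel's inequality makes the expansion of \<open>x\<close> converge to some
  \<open>y\<close>. The difference \<open>x - y\<close> is orthogonal to \<open>E\<close>, hence 0,
  and pairing the expansion with \<open>x\<close> gives the identity.\<close>

lemma parseval:
  assumes E: "is_onb E"
  shows "((\<lambda>e. (cmod (cinner x e))\<^sup>2) has_sum (norm x)\<^sup>2) E"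
proof -
  have on: "cinner e e' = (if e = e' then 1 else 0)" if "e \<in> E" "e' \<in> E" for e e'
    using E that by (simp add: is_onb_def orthonormal_def)
  let ?a = "\<lambda>e. cinner x e"
  have sq: "(norm (\<Sum>e\<in>F. ?a e *\<^sub>C e))\<^sup>2 = (\<Sum>e\<in>F. (cmod (?a e))\<^sup>2)"
    and cross: "Re (cinner x (\<Sum>e\<in>F. ?a e *\<^sub>C e)) = (\<Sum>e\<in>F. (cmod (?a e))\<^sup>2)"
    if F: "finite F" "F \<subseteq> E" for F
  proof -
    let ?P = "\<Sum>e\<in>F. ?a e *\<^sub>C e"
    have c: "cinner x ?P = complex_of_real (\<Sum>e\<in>F. (cmod (?a e))\<^sup>2)"
      by (simp add: cinner_sum_right cinner_scaleC_right mult.commute[of "cnj _"]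
          complex_norm_square[symmetric])
    have "cinner ?P e = ?a e" if "e \<in> F" for e
    proof -
      have "cinner ?P e = (\<Sum>e'\<in>F. if e' = e then ?a e' else 0)"
        unfolding cinner_sum_left cinner_scaleC_left
        using F that by (intro sum.cong) (auto simp: on subset_iff)
      then show ?thesis
        using F that by simp
    qed
    then have "(\<Sum>e\<in>F. cnj (?a e) * cinner ?P e) = (\<Sum>e\<in>F. cnj (?a e) * ?a e)"
      by (intro sum.cong) auto
    then have "cinner ?P ?P = cinner x ?P"
      by (simp only: cinner_sum_right cinner_scaleC_right)
    then have "complex_of_real ((norm ?P)\<^sup>2) = complex_of_real (\<Sum>e\<in>F. (cmod (?a e))\<^sup>2)"
      by (simp only: cinner_self c)
    then show "(norm ?P)\<^sup>2 = (\<Sum>e\<in>F. (cmod (?a e))\<^sup>2)"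
      by (simp only: of_real_eq_iff)
    from c show "Re (cinner x ?P) = (\<Sum>e\<in>F. (cmod (?a e))\<^sup>2)"
      by simp
  qed
  have bessel: "(\<Sum>e\<in>F. (cmod (?a e))\<^sup>2) \<le> (norm x)\<^sup>2" if F: "finite F" "F \<subseteq> E" for F
  proof (cases "(\<Sum>e\<in>F. (cmod (?a e))\<^sup>2) = 0")
    case False
    define s where "s = (\<Sum>e\<in>F. (cmod (?a e))\<^sup>2)"
    have "s > 0"
      using False by (simp add: s_def sum_nonneg order_less_le)
    \<comment> \<open>The partial expansion has squared norm \<open>s\<close> and its inner product
      with \<open>x\<close> also has real part \<open>s\<close>, so Cauchy-Schwarz applies.\<close>
    have "s \<le> norm x * sqrt s"
      using Re_cinner_le[of x "\<Sum>e\<in>F. ?a e *\<^sub>C e"]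
        real_sqrt_unique[OF sq[OF F] norm_ge_zero] unfolding cross[OF F] by (simp add: s_def)
    then have "sqrt s * sqrt s \<le> norm x * sqrt s"
      using \<open>s > 0\<close> by simp
    then have "sqrt s \<le> norm x"
      by (rule mult_right_le_imp_le) (use \<open>s > 0\<close> in simp)
    then have "s \<le> (norm x)\<^sup>2"
      by (rule sqrt_le_D)
    then show ?thesis
      by (simp add: s_def)
  qed simp
  have "(\<lambda>e. (cmod (?a e))\<^sup>2) summable_on E"
    using bessel by (intro nonneg_bounded_partial_sums_imp_summable_on[where C = "(norm x)\<^sup>2"]
        eventually_finite_subsets_at_top_weakI) auto
  then have "(\<lambda>e. ?a e *\<^sub>C e) summable_on E"
    by (rule summable_on_if_norm_sum_sq_le[where B = 1]) (simp add: sq)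
  then obtain y where y: "((\<lambda>e. ?a e *\<^sub>C e) has_sum y) E"
    by (auto simp: summable_on_def)
  have "cinner (x - y) e = 0" if "e \<in> E" for e
  proof -
    have "((\<lambda>e'. cinner (?a e' *\<^sub>C e') e) has_sum cinner y e) E"
      by (rule has_sum_bounded_linear[OF bounded_linear_cinner_left y])
    moreover have "((\<lambda>e'. cinner (?a e' *\<^sub>C e') e) has_sum ?a e) E"
      using that on by (intro has_sum_finite_neutralI[of "{e}"]) (auto simp: cinner_scaleC_left)
    ultimately have "cinner y e = ?a e"
      by (rule has_sum_unique)
    then show ?thesis
      by (simp add: bounded_bilinear.diff_left[OF bounded_bilinear_cinner])
  qed
  with E have "x - y = 0"
    unfolding is_onb_def by blast
  then have "((\<lambda>e. ?a e *\<^sub>C e) has_sum x) E"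
    using y by simp
  from has_sum_Re[OF has_sum_bounded_linear[OF bounded_linear_cinner_right[of x] this]]
  show ?thesis
    by (simp add: cinner_self cinner_scaleC_right mult.commute[of "cnj _"]
        complex_norm_square[symmetric])
qed

section \<open>The Hilbert-Schmidt inner product\<close>

text \<open>The squared matrix entries of \<open>T\<close> are summed by rows and by columns:
  Parseval turns the rows into \<open>(norm (T e))^2\<close> and the columns into
  \<open>(norm (T' f))^2\<close>.\<close>

lemma summable_on_adjoint_onb:
  assumes E: "is_onb E" and F: "is_onb F"
    and adj: "\<And>x y. cinner (T x) y = cinner x (T' y)"
    and T: "(\<lambda>e. (norm (T e))\<^sup>2) summable_on E"
  shows "(\<lambda>f. (norm (T' f))\<^sup>2) summable_on F"
proof -
  have "(\<lambda>(e, f). (cmod (cinner (T e) f))\<^sup>2) summable_on E \<times> F"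
    by (rule summable_on_SigmaI[OF _ T]) (use parseval[OF F] in auto)
  then have "(\<lambda>(f, e). (cmod (cinner (T e) f))\<^sup>2) summable_on F \<times> E"
    by (subst (asm) summable_on_swap) (simp add: case_prod_beta)
  then have "(\<lambda>f. \<Sum>\<^sub>\<infinity>e\<in>E. (cmod (cinner (T e) f))\<^sup>2) summable_on F"
    by (rule summable_on_Sigma_banach)
  moreover have "(\<Sum>\<^sub>\<infinity>e\<in>E. (cmod (cinner (T e) f))\<^sup>2) = (norm (T' f))\<^sup>2" for f
  proof -
    have "cmod (cinner (T e) f) = cmod (cinner (T' f) e)" for e
      by (metis adj cinner_commute complex_mod_cnj)
    then show ?thesis
      using infsumI[OF parseval[OF E, of "T' f"]] by simp
  qed
  ultimately show ?thesis
    by simp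
qed

text \<open>Membership supplies only some basis, while \<open>trace_op\<close> uses
  \<open>some_onb\<close>. Passing to the adjoint moves from \<open>E\<close> to \<open>F\<close>,
  and passing back keeps \<open>F\<close>.\<close>

lemma hs_class_summable_onb:
  assumes "T \<in> hs_class" and F: "is_onb F"
  shows "(\<lambda>e. (norm (T e))\<^sup>2) summable_on F"
proof -
  obtain E where T: "bounded_clinear T" and E: "is_onb E" "(\<lambda>e. (norm (T e))\<^sup>2) summable_on E"
    using assms(1) by (auto simp: hs_class_def)
  have adj: "cinner (T x) y = cinner x (cadjoint T y)" for x y
    by (rule cinner_cadjoint[OF T])
  have adj': "cinner (cadjoint T y) x = cinner y (T x)" for x y
    by (metis adj cinner_commute)
  show ?thesis
    by (rule summable_on_adjoint_onb[OF F F adj' summable_on_adjoint_onb[OF E(1) F adj E(2)]])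
qed

text \<open>Shows that the trace is a genuine sum and not the default value 0: its terms are
  dominated by \<open>(norm (T e))^2 + (norm (S e))^2\<close>.\<close>

lemma hs_inner_has_sum:
  assumes T: "T \<in> hs_class" and S: "S \<in> hs_class"
  shows "((\<lambda>e. cinner (T e) (S e)) has_sum hs_inner T S) some_onb"
proof -
  have sum: "(\<lambda>e. (norm (T e))\<^sup>2 + (norm (S e))\<^sup>2) summable_on some_onb"
    by (intro summable_on_add hs_class_summable_onb T S is_onb_some_onb)
  have le: "norm (cinner (T e) (S e)) \<le> (norm (T e))\<^sup>2 + (norm (S e))\<^sup>2" for e
  proof -
    have "norm (T e) * norm (S e) \<le> (norm (T e))\<^sup>2 + (norm (S e))\<^sup>2"
      using sum_squares_bound[of "norm (T e)" "norm (S e)"]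
        mult_nonneg_nonneg[of "norm (T e)" "norm (S e)"]
      by (simp del: mult_nonneg_nonneg)
    then show ?thesis
      using cmod_cinner_le order_trans by blast
  qed
  have "(\<lambda>e. norm (cinner (T e) (S e))) summable_on some_onb"
    by (rule Infinite_Sum.abs_summable_on_comparison_test'[OF sum le])
  then have "(\<lambda>e. cinner (T e) (S e)) summable_on some_onb"
    by (rule abs_summable_summable)
  moreover have "cinner (cadjoint S y) e = cinner y (S e)" for y e
  proof -
    have "bounded_clinear S"
      using S by (simp add: hs_class_def)
    then show ?thesis
      by (metis cinner_cadjoint cinner_commute)
  qed
  ultimately show ?thesis
    by (simp add: hs_inner_def trace_op_def)
qed

lemma
  assumes "T \<in> hs_class"
  shows hs_norm_has_sum: "((\<lambda>e. (norm (T e))\<^sup>2) has_sum (hs_norm T)\<^sup>2) some_onb"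
    and hs_norm_nonneg: "0 \<le> hs_norm T"
proof -
  have *: "((\<lambda>e. (norm (T e))\<^sup>2) has_sum Re (hs_inner T T)) some_onb"
    using has_sum_Re[OF hs_inner_has_sum[OF assms assms]] by (simp add: cinner_self)
  then have "0 \<le> Re (hs_inner T T)"
    by (rule has_sum_nonneg) simp
  with * show "((\<lambda>e. (norm (T e))\<^sup>2) has_sum (hs_norm T)\<^sup>2) some_onb" "0 \<le> hs_norm T"
    by (simp_all add: hs_norm_def)
qed

lemma hs_inner_self:
  assumes T: "T \<in> hs_class"
  shows "hs_inner T T = complex_of_real ((hs_norm T)\<^sup>2)"
  using hs_inner_has_sum[OF T T] has_sum_of_real[OF hs_norm_has_sum[OF T]]
  unfolding cinner_self by (rule has_sum_unique)

lemma cmod_hs_inner_le: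
  assumes "T \<in> hs_class" "S \<in> hs_class"
  shows "cmod (hs_inner T S) \<le> hs_norm T * hs_norm S"
  using has_sum_Cauchy_Schwarz[OF hs_inner_has_sum[OF assms] cmod_cinner_le
      hs_norm_has_sum[OF assms(1)] hs_norm_has_sum[OF assms(2)]]
  by (simp add: hs_norm_nonneg assms)

lemma hs_inner_commute:
  assumes "T \<in> hs_class" "S \<in> hs_class"
  shows "hs_inner T S = cnj (hs_inner S T)"
proof -
  have "((\<lambda>e. cnj (cinner (S e) (T e))) has_sum cnj (hs_inner S T)) some_onb"
    using hs_inner_has_sum[OF assms(2,1)] by simp
  then have "((\<lambda>e. cinner (T e) (S e)) has_sum cnj (hs_inner S T)) some_onb"
    by (simp add: cinner_commute[symmetric])
  with hs_inner_has_sum[OF assms] show ?thesis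
    by (rule has_sum_unique)
qed

lemma bounded_hs_operatorD:
  assumes "bounded_hs_operator G"
  shows "G f \<in> hs_class" "G (f + g) x = G f x + G g x" "G (c *\<^sub>C f) x = c *\<^sub>C G f x"
  using assms unfolding bounded_hs_operator_def by auto

lemma bounded_linear_hs_inner:
  assumes G: "bounded_hs_operator G" and T: "T \<in> hs_class"
  shows "bounded_linear (\<lambda>f. hs_inner (G f) T)" "hs_inner (G (c *\<^sub>C f)) T = c * hs_inner (G f) T"
proof -
  note G' = bounded_hs_operatorD[OF G]
  have add: "hs_inner (G (f + g)) T = hs_inner (G f) T + hs_inner (G g) T" for f g
    using has_sum_add[OF hs_inner_has_sum[OF G'(1)[of f] T] hs_inner_has_sum[OF G'(1)[of g] T]]
    by (intro has_sum_unique[OF hs_inner_has_sum[OF G'(1) T]]) (simp add: G' cinner_add_left)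
  show scale: "hs_inner (G (c *\<^sub>C f)) T = c * hs_inner (G f) T" for c f
    using has_sum_cmult_right[OF hs_inner_has_sum[OF G'(1)[of f] T], of c]
    by (intro has_sum_unique[OF hs_inner_has_sum[OF G'(1) T]]) (simp add: G' cinner_scaleC_left)
  obtain C where C: "\<And>f. hs_norm (G f) \<le> C * norm f"
    using G by (auto simp: bounded_hs_operator_def)
  show "bounded_linear (\<lambda>f. hs_inner (G f) T)"
  proof (rule bounded_linear_intro[where K = "C * hs_norm T"])
    fix f
    have "norm (hs_inner (G f) T) \<le> hs_norm (G f) * hs_norm T"
      by (rule cmod_hs_inner_le[OF G'(1) T])
    also have "\<dots> \<le> (C * norm f) * hs_norm T"
      by (intro mult_right_mono C hs_norm_nonneg T)
    finally show "norm (hs_inner (G f) T) \<le> norm f * (C * hs_norm T)"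
      by (simp add: mult_ac)
    fix r
    show "hs_inner (G (r *\<^sub>R f)) T = r *\<^sub>R hs_inner (G f) T"
      using scale[of "complex_of_real r" f] by (simp add: scaleC_of_real scaleR_conv_of_real)
  qed (rule add)
qed

lemma hs_inner_hs_adjoint:
  assumes "bounded_hs_operator G" "T \<in> hs_class"
  shows "hs_inner (G f) T = cinner f (hs_adjoint G T)"
  using theI'[OF riesz_representation[OF bounded_linear_hs_inner[OF assms]]]
  unfolding hs_adjoint_def by blast

section \<open>The frame operator\<close>

text \<open>Names the existentially quantified frame bounds, so that later estimates can share
  \<open>A\<close> and \<open>B\<close>.\<close>

locale hs_frame_bounds =
  fixes J :: "'i set" and G :: "'i \<Rightarrow> 'h::complex_hilbert \<Rightarrow> 'k::complex_hilbert \<Rightarrow> 'k"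
    and A B :: real
  assumes bounded: "j \<in> J \<Longrightarrow> bounded_hs_operator (G j)"
    and A_pos: "0 < A" and B_pos: "0 < B"
    and summable: "(\<lambda>j. (hs_norm (G j f))\<^sup>2) summable_on J"
    and lower: "A * (norm f)\<^sup>2 \<le> (\<Sum>\<^sub>\<infinity>j\<in>J. (hs_norm (G j f))\<^sup>2)"
    and upper: "(\<Sum>\<^sub>\<infinity>j\<in>J. (hs_norm (G j f))\<^sup>2) \<le> B * (norm f)\<^sup>2"
begin

lemma in_hs_class: "j \<in> J \<Longrightarrow> G j f \<in> hs_class"
  using bounded_hs_operatorD(1)[OF bounded] .

lemma summable_subset: "K \<subseteq> J \<Longrightarrow> (\<lambda>j. (hs_norm (G j f))\<^sup>2) summable_on K"
  using summable by (rule summable_on_subset_banach)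

lemma upper_subset: "K \<subseteq> J \<Longrightarrow> (\<Sum>\<^sub>\<infinity>j\<in>K. (hs_norm (G j f))\<^sup>2) \<le> B * (norm f)\<^sup>2"
  using upper by (rule order_trans[rotated]) (intro infsum_mono2 summable_subset summable; auto)

text \<open>Meant for \<open>h\<close> the sum of \<open>hs_adjoint (G j) (G j f)\<close> over
  \<open>K\<close>. Cauchy-Schwarz and the upper frame bound at \<open>h\<close> leave a factor
  \<open>(norm h)^2\<close> to cancel. Finite \<open>K\<close> gives convergence of the series,
  general \<open>K\<close> the bound on its sum.\<close>

lemma norm_sq_le_if_has_sum:
  assumes K: "K \<subseteq> J"
    and h: "((\<lambda>j. hs_inner (G j h) (G j f)) has_sum cinner h h) K"
  shows "(norm h)\<^sup>2 \<le> B * (\<Sum>\<^sub>\<infinity>j\<in>K. (hs_norm (G j f))\<^sup>2)"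
proof -
  let ?s = "\<lambda>f. \<Sum>\<^sub>\<infinity>j\<in>K. (hs_norm (G j f))\<^sup>2"
  have s: "0 \<le> ?s f" for f
    by (intro infsum_nonneg) auto
  have "norm (cinner h h) \<le> sqrt (?s h) * sqrt (?s f)"
    by (rule has_sum_Cauchy_Schwarz[OF h cmod_hs_inner_le])
      (use K in \<open>auto intro!: in_hs_class has_sum_infsum summable_subset\<close>)
  then have "((norm h)\<^sup>2)\<^sup>2 \<le> (sqrt (?s h) * sqrt (?s f))\<^sup>2"
    by (intro power_mono) (auto simp: cinner_self norm_power)
  also have "\<dots> = ?s h * ?s f"
    using s by (simp add: power_mult_distrib)
  also have "\<dots> \<le> (B * (norm h)\<^sup>2) * ?s f"
    using s by (intro mult_right_mono upper_subset K)
  finally have le: "(norm h)\<^sup>2 * (norm h)\<^sup>2 \<le> (norm h)\<^sup>2 * (B * ?s f)"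
    by (simp add: power2_eq_square mult_ac)
  show ?thesis
  proof (cases "h = 0")
    case False
    then show ?thesis
      using mult_left_le_imp_le[OF le] by simp
  qed (use s[of f] B_pos in simp)
qed

lemma partial_frame_op_has_sum:
  assumes K: "K \<subseteq> J"
  shows "((\<lambda>j. hs_adjoint (G j) (G j f)) has_sum partial_frame_op G K f) K"
proof -
  have "(norm (\<Sum>j\<in>F. hs_adjoint (G j) (G j f)))\<^sup>2 \<le> B * (\<Sum>j\<in>F. (hs_norm (G j f))\<^sup>2)"
    if F: "finite F" "F \<subseteq> K" for F
  proof -
    let ?h = "\<Sum>j\<in>F. hs_adjoint (G j) (G j f)"
    have FJ: "F \<subseteq> J"
      using F K by blast
    then have "(\<Sum>j\<in>F. hs_inner (G j ?h) (G j f)) = (\<Sum>j\<in>F. cinner ?h (hs_adjoint (G j) (G j f)))"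
      by (intro sum.cong hs_inner_hs_adjoint bounded in_hs_class) auto
    also have "\<dots> = cinner ?h ?h"
      by (rule cinner_sum_right[symmetric])
    finally have "((\<lambda>j. hs_inner (G j ?h) (G j f)) has_sum cinner ?h ?h) F"
      using F by (intro has_sum_finiteI) auto
    from norm_sq_le_if_has_sum[OF FJ this] F show ?thesis
      by simp
  qed
  then have "(\<lambda>j. hs_adjoint (G j) (G j f)) summable_on K"
    by (rule summable_on_if_norm_sum_sq_le[OF summable_subset[OF K]])
  then show ?thesis
    by (simp add: partial_frame_op_def)
qed

text \<open>The weak form of the operator, from which symmetry, the diagonal values and the norm
  bound follow.\<close>

lemma cinner_partial_frame_op:
  assumes K: "K \<subseteq> J"
  shows "((\<lambda>j. hs_inner (G j g) (G j f)) has_sum cinner g (partial_frame_op G K f)) K"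
proof -
  have "((\<lambda>j. cinner g (hs_adjoint (G j) (G j f))) has_sum cinner g (partial_frame_op G K f)) K"
    by (rule has_sum_bounded_linear[OF bounded_linear_cinner_right partial_frame_op_has_sum[OF K]])
  also have "?this \<longleftrightarrow> ?thesis"
    using K by (intro has_sum_cong hs_inner_hs_adjoint[symmetric] bounded in_hs_class) auto
  finally show ?thesis .
qed

lemma partial_frame_op_symmetric:
  assumes K: "K \<subseteq> J"
  shows "cinner (partial_frame_op G K f) g = cinner f (partial_frame_op G K g)"
proof -
  have "((\<lambda>j. cnj (hs_inner (G j g) (G j f))) has_sum cnj (cinner g (partial_frame_op G K f))) K"
    using cinner_partial_frame_op[OF K] by simp
  also have "?this \<longleftrightarrow> ((\<lambda>j. hs_inner (G j f) (G j g)) has_sum cnj (cinner g (partial_frame_op G K f))) K"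
    using K by (intro has_sum_cong hs_inner_commute[symmetric] in_hs_class) auto
  finally have "cnj (cinner g (partial_frame_op G K f)) = cinner f (partial_frame_op G K g)"
    using cinner_partial_frame_op[OF K] by (rule has_sum_unique)
  then show ?thesis
    by (simp add: cinner_commute[symmetric])
qed

lemma cinner_partial_frame_op_self:
  assumes K: "K \<subseteq> J"
  shows "cinner f (partial_frame_op G K f) = complex_of_real (\<Sum>\<^sub>\<infinity>j\<in>K. (hs_norm (G j f))\<^sup>2)"
proof -
  have "((\<lambda>j. complex_of_real ((hs_norm (G j f))\<^sup>2)) has_sum cinner f (partial_frame_op G K f)) K"
    using cinner_partial_frame_op[OF K, of f f]
    by (rule has_sum_cong[THEN iffD1, rotated]) (use K in \<open>auto simp: hs_inner_self in_hs_class\<close>)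
  moreover have "((\<lambda>j. complex_of_real ((hs_norm (G j f))\<^sup>2)) has_sum
      complex_of_real (\<Sum>\<^sub>\<infinity>j\<in>K. (hs_norm (G j f))\<^sup>2)) K"
    by (intro has_sum_of_real has_sum_infsum summable_subset K)
  ultimately show ?thesis
    by (rule has_sum_unique)
qed

section \<open>Boundedness and invertibility\<close>

lemma bounded_linear_partial_frame_op:
  assumes K: "K \<subseteq> J"
  shows "bounded_linear (partial_frame_op G K)"
proof (rule bounded_linear_intro[where K = B])
  fix f g :: 'h and r :: real
  \<comment> \<open>By symmetry the operator moves to the test vector, where linearity in the other
    slot is that of the inner product.\<close>
  show "partial_frame_op G K (f + g) = partial_frame_op G K f + partial_frame_op G K g"
    by (rule eq_if_Re_cinner_eq)
      (simp add: partial_frame_op_symmetric[OF K, symmetric] cinner_add_left cinner_add_right)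
  show "partial_frame_op G K (r *\<^sub>R f) = r *\<^sub>R partial_frame_op G K f"
    by (rule eq_if_Re_cinner_eq)
      (simp add: partial_frame_op_symmetric[OF K, symmetric] cinner_scaleR_right)
  have "(norm (partial_frame_op G K f))\<^sup>2 \<le> B * (\<Sum>\<^sub>\<infinity>j\<in>K. (hs_norm (G j f))\<^sup>2)"
    by (rule norm_sq_le_if_has_sum[OF K cinner_partial_frame_op[OF K]])
  also have "\<dots> \<le> B * (B * (norm f)\<^sup>2)"
    using B_pos by (intro mult_left_mono upper_subset K) auto
  also have "\<dots> = (norm f * B)\<^sup>2"
    by (simp add: power2_eq_square)
  finally show "norm (partial_frame_op G K f) \<le> norm f * B"
    using B_pos by (auto intro: power2_le_imp_le)
qed

lemma partial_frame_op_Un: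
  assumes "K \<subseteq> J"
  shows "partial_frame_op G K f + partial_frame_op G (J - K) f = partial_frame_op G J f"
proof -
  have "((\<lambda>j. hs_adjoint (G j) (G j f)) has_sum
      partial_frame_op G K f + partial_frame_op G (J - K) f) (K \<union> (J - K))"
    using assms by (intro has_sum_Un_disjoint partial_frame_op_has_sum) auto
  moreover have "K \<union> (J - K) = J"
    using assms by blast
  ultimately show ?thesis
    using has_sum_unique[OF _ partial_frame_op_has_sum[OF order_refl]] by metis
qed

text \<open>The lower frame bound says that the form of \<open>S\<close> is coercive. This gives
  injectivity at once, and surjectivity by representing the functional of \<open>y\<close> through
  that form.\<close>

lemma bij_frame_op: "bij (partial_frame_op G J)"
proof (rule bijI)
  let ?S = "partial_frame_op G J"
  interpret S: bounded_linear ?S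
    by (rule bounded_linear_partial_frame_op) simp
  have coercive: "A * (norm x)\<^sup>2 \<le> Re (cinner x (?S x))" for x
    using lower by (simp add: cinner_partial_frame_op_self)
  show "inj ?S"
  proof (rule injI)
    fix x y assume "?S x = ?S y"
    then have "A * (norm (x - y))\<^sup>2 \<le> 0"
      using coercive[of "x - y"]
      by (simp add: S.diff bounded_bilinear.zero_right[OF bounded_bilinear_cinner])
    then show "x = y"
      using A_pos by (simp add: mult_le_0_iff)
  qed
  show "surj ?S"
  proof (rule surjI)
    have bil: "bounded_bilinear (\<lambda>x y. Re (cinner x (?S y)))"
      by (rule bounded_bilinear.comp[OF bounded_bilinear_Re_cinner bounded_linear_ident
            S.bounded_linear_axioms])
    fix y
    have "\<exists>z. \<forall>x. Re (cinner x y) = Re (cinner x (?S z))"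
      by (rule symmetric_lax_milgram[OF bil _ A_pos coercive])
        (metis Re_cinner_commute partial_frame_op_symmetric order_refl,
          intro bounded_linear_compose[OF bounded_linear_Re bounded_linear_cinner_left])
    then show "?S (SOME z. ?S z = y) = y"
      by (intro someI_ex[of "\<lambda>z. ?S z = y"]) (metis eq_if_Re_cinner_eq)
  qed
qed

end

section \<open>The quadratic form computation\<close>

text \<open>
  With \<open>u\<close> and \<open>v\<close> the preimages of \<open>partial_frame_op G K f\<close> and
  \<open>partial_frame_op G (J - K) f\<close> under the frame operator \<open>S\<close>, one has \<open>u + v = f\<close>, and all sums
  are values of the form \<open>\<langle>x, S y\<rangle>\<close>. The difference of the two sides of the inequality
  is this form evaluated at \<open>(1 - lam) u - lam v\<close>.
\<close>

theorem theorem3p5: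
  fixes J K :: "'i set"
    and G :: "'i \<Rightarrow> 'h::complex_hilbert \<Rightarrow> 'k::complex_hilbert \<Rightarrow> 'k"
    and f :: 'h and lam :: real
  assumes "countable J"
    and "hs_frame J G"
    and "0 \<le> lam" and "lam \<le> 1"
    and "K \<subseteq> J"
  shows
    "(\<Sum>\<^sub>\<infinity>j\<in>J. (hs_norm (canonical_dual J G j (partial_frame_op G K f)))\<^sup>2)
       + (\<Sum>\<^sub>\<infinity>j\<in>J - K. (hs_norm (G j f))\<^sup>2)
     = (\<Sum>\<^sub>\<infinity>j\<in>J. (hs_norm (canonical_dual J G j (partial_frame_op G (J - K) f)))\<^sup>2)
       + (\<Sum>\<^sub>\<infinity>j\<in>K. (hs_norm (G j f))\<^sup>2)
     \<and>
     (\<Sum>\<^sub>\<infinity>j\<in>J. (hs_norm (canonical_dual J G j (partial_frame_op G (J - K) f)))\<^sup>2)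
       + (\<Sum>\<^sub>\<infinity>j\<in>K. (hs_norm (G j f))\<^sup>2)
     \<ge> (2 * lam - lam\<^sup>2) * (\<Sum>\<^sub>\<infinity>j\<in>K. (hs_norm (G j f))\<^sup>2)
       + (1 - lam\<^sup>2) * (\<Sum>\<^sub>\<infinity>j\<in>J - K. (hs_norm (G j f))\<^sup>2)"
proof -
  obtain A B where "hs_frame_bounds J G A B"
    using assms(2) unfolding hs_frame_def hs_frame_bounds_def by blast
  then interpret hs_frame_bounds J G A B .
  define S where "S = partial_frame_op G J"
  interpret S: bounded_linear S
    unfolding S_def by (rule bounded_linear_partial_frame_op) simp
  define q where "q x y = Re (cinner x (S y))" for x y
  have q_commute: "q x y = q y x" for x y
    unfolding q_def S_def
    by (metis Re_cinner_commute partial_frame_op_symmetric order_refl)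
  have q_self: "q x x = (\<Sum>\<^sub>\<infinity>j\<in>J. (hs_norm (G j x))\<^sup>2)" for x
    by (simp add: q_def S_def cinner_partial_frame_op_self)
  have q_nonneg: "0 \<le> q x x" for x
    unfolding q_self by (intro infsum_nonneg) simp
  have q_add_left: "q (x + y) z = q x z + q y z"
    and q_scale_left: "q (r *\<^sub>R x) z = r * q x z" for x y z r
    by (simp_all add: q_def cinner_add_left cinner_scaleR_left)
  have q_add_right: "q z (x + y) = q z x + q z y"
    and q_scale_right: "q z (r *\<^sub>R x) = r * q z x" for x y z r
    using q_add_left q_scale_left q_commute by metis+
  have S_inv: "S (inv S y) = y" for y
    using bij_frame_op by (simp add: S_def bij_is_surj surj_f_inv_f)
  define u v where "u = inv S (partial_frame_op G K f)" and "v = inv S (partial_frame_op G (J - K) f)"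
  have Su: "S u = partial_frame_op G K f" and Sv: "S v = partial_frame_op G (J - K) f"
    by (simp_all add: u_def v_def S_inv)
  have "S (u + v) = S f"
    using partial_frame_op_Un[OF assms(5)] by (simp add: S.add Su Sv) (simp add: S_def)
  then have f: "f = u + v"
    using bij_frame_op by (auto simp: S_def bij_def inj_eq)
  have dual: "(\<Sum>\<^sub>\<infinity>j\<in>J. (hs_norm (canonical_dual J G j y))\<^sup>2) = q (inv S y) (inv S y)" for y
    by (simp add: canonical_dual_def q_self S_def)
  have K: "(\<Sum>\<^sub>\<infinity>j\<in>K. (hs_norm (G j f))\<^sup>2) = q u u + q u v"
  proof -
    \<comment> \<open>The sum is the diagonal value of \<open>partial_frame_op G K\<close> at
      \<open>f\<close>, and \<open>S u\<close> equals that operator applied to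
      \<open>f\<close>.\<close>
    have "(\<Sum>\<^sub>\<infinity>j\<in>K. (hs_norm (G j f))\<^sup>2) = q f u"
      using assms(5) by (simp add: q_def Su cinner_partial_frame_op_self)
    then show ?thesis
      unfolding f q_add_left using q_commute[of v u] by simp
  qed
  have Kc: "(\<Sum>\<^sub>\<infinity>j\<in>J - K. (hs_norm (G j f))\<^sup>2) = q v v + q u v"
  proof -
    have "(\<Sum>\<^sub>\<infinity>j\<in>J - K. (hs_norm (G j f))\<^sup>2) = q f v"
      by (simp add: q_def Sv cinner_partial_frame_op_self)
    then show ?thesis
      unfolding f q_add_left by simp
  qed
  have "0 \<le> q ((1 - lam) *\<^sub>R u + (- lam) *\<^sub>R v) ((1 - lam) *\<^sub>R u + (- lam) *\<^sub>R v)"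
    by (rule q_nonneg)
  also have "\<dots> = (1 - lam)\<^sup>2 * q u u - 2 * lam * (1 - lam) * q u v + lam\<^sup>2 * q v v"
    unfolding q_add_left q_add_right q_scale_left q_scale_right q_commute[of v u]
    by (simp add: power2_eq_square algebra_simps)
  \<comment> \<open>The expanded square is exactly the right side minus the left side, by comparing
    the coefficients of \<open>q u u\<close>, \<open>q u v\<close> and \<open>q v v\<close>.\<close>
  finally have "(2 * lam - lam\<^sup>2) * (q u u + q u v) + (1 - lam\<^sup>2) * (q v v + q u v)
      \<le> q v v + (q u u + q u v)"
    by (simp add: power2_eq_square algebra_simps)
  then show ?thesis
    unfolding dual K Kc u_def[symmetric] v_def[symmetric] by simp
qed

end
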